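(* For every prime $p$ and every integer $n\ge 1$, the Chermak-Delgado measure of the mod $p^n$ Heisenberg group $\mathcal{H}(p^n)$ is $m^{\ast}(\mathcal{H}(p^n)) = p^{4n}$.
   Context: For a finite group $G$ and a subgroup $H\le G$, let $C(H)$ be the centralizer of $H$ in $G$ and $m(H)=|H|\,|C(H)|$. The Chermak-Delgado measure of $G$ is $m^{\ast}(G)=\max\{m(H) : H\le G\}$. $\mathcal{H}(p^n)$ is the group of $3\times 3$ upper unitriangular matrices with entries in the ring $\mathbb{Z}_{p^n}=\mathbb{Z}/p^n\mathbb{Z}$, under matrix multiplication. *)

theory Defs
  imports "Jordan_Normal_Form.Matrix" "HOL-Number_Theory.Residues"
begin

definition centralizer :: "('a, 'b) monoid_scheme \<Rightarrow> 'a set \<Rightarrow> 'a set" where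
  "centralizer G H = {g \<in> carrier G. \<forall>h\<in>H. g \<otimes>\<^bsub>G\<^esub> h = h \<otimes>\<^bsub>G\<^esub> g}"

definition cd_measure_of :: "('a, 'b) monoid_scheme \<Rightarrow> 'a set \<Rightarrow> nat" where
  "cd_measure_of G H = card H * card (centralizer G H)"

definition cd_measure :: "('a, 'b) monoid_scheme \<Rightarrow> nat" where
  "cd_measure G = Max {cd_measure_of G H | H. subgroup H G}"

text \<open>The library's matrix product is tied to the type-class operations of the entry type;
  here the sums and products are those of the ring structure \<open>R\<close>.\<close>

definition unitriangular_group :: "('a, 'b) ring_scheme \<Rightarrow> nat \<Rightarrow> 'a mat monoid" where
  "unitriangular_group R d =
    \<lparr>carrier = {A \<in> carrier_mat d d.
        (\<forall>i<d. \<forall>j<d. A $$ (i, j) \<in> carrier R) \<and>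
        (\<forall>i<d. A $$ (i, i) = \<one>\<^bsub>R\<^esub>) \<and>
        (\<forall>i<d. \<forall>j<i. A $$ (i, j) = \<zero>\<^bsub>R\<^esub>)},
     monoid.mult = (\<lambda>A B. mat d d
        (\<lambda>(i, j). \<Oplus>\<^bsub>R\<^esub>k\<in>{..<d}. A $$ (i, k) \<otimes>\<^bsub>R\<^esub> B $$ (k, j))),
     one = mat d d (\<lambda>(i, j). if i = j then \<one>\<^bsub>R\<^esub> else \<zero>\<^bsub>R\<^esub>)\<rparr>"

definition heisenberg_group :: "nat \<Rightarrow> int mat monoid" where
  "heisenberg_group N = unitriangular_group (residue_ring (int N)) 3"

lemma (in ring) finsum_lessThan_3:
  assumes "f 0 \<in> carrier R" "f 1 \<in> carrier R" "f 2 \<in> carrier R"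
  shows "(\<Oplus>k\<in>{..<3::nat}. f k) = f 2 \<oplus> (f 1 \<oplus> f 0)"
proof -
  have "{..<3::nat} = insert 2 (insert 1 (insert 0 {}))" by auto
  then show ?thesis using assms by (simp add: finsum_insert Pi_iff)
qed

lemma all_less_3: "(\<forall>i<3::nat. P i) \<longleftrightarrow> P 0 \<and> P 1 \<and> P 2"
  by (auto simp: numeral_eq_Suc less_Suc_eq)

lemma mat3_eqI:
  assumes "A \<in> carrier_mat 3 3" "B \<in> carrier_mat 3 3"
    "\<forall>i<3. \<forall>j<3. A $$ (i, j) = B $$ (i, j)"
  shows "A = B"
  using assms by (intro eq_matI) auto

lemma (in ring) group_unitriangular_group_3: "group (unitriangular_group R 3)"
proof (rule groupI, goal_cases)
  case (1 x y)
  then show ?case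
    by (simp add: unitriangular_group_def all_less_3 finsum_lessThan_3 less_Suc_eq
        numeral_eq_Suc[of "num.Bit0 num.One"])
next
  case 2
  then show ?case
    by (simp add: unitriangular_group_def all_less_3)
next
  case (3 x y z)
  then show ?case
    by (intro mat3_eqI) (simp_all add: unitriangular_group_def all_less_3 finsum_lessThan_3
        less_Suc_eq numeral_eq_Suc[of "num.Bit0 num.One"] a_ac l_distr r_distr m_assoc)
next
  case (4 x)
  then show ?case
    by (intro mat3_eqI) (simp_all add: unitriangular_group_def all_less_3 finsum_lessThan_3
        less_Suc_eq numeral_eq_Suc[of "num.Bit0 num.One"])
next
  case (5 x)
  define a b c where "a = x $$ (0, 1)" and "b = x $$ (1, 2)" and "c = x $$ (0, 2)"
  define y where "y = mat 3 3 (\<lambda>(i, j). if i = j then \<one> else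
     if i = 0 \<and> j = 1 then \<ominus> a else if i = 1 \<and> j = 2 then \<ominus> b else
     if i = 0 \<and> j = 2 then a \<otimes> b \<oplus> \<ominus> c else \<zero>)"
  have abc [simp]: "a \<in> carrier R" "b \<in> carrier R" "c \<in> carrier R"
    using 5 by (simp_all add: a_def b_def c_def unitriangular_group_def)
  have y: "y \<in> carrier (unitriangular_group R 3)"
    by (simp add: unitriangular_group_def y_def all_less_3 less_Suc_eq
        numeral_eq_Suc[of "num.Bit0 num.One"])
  have key: "a \<otimes> b \<oplus> \<ominus> c \<oplus> (\<ominus> a \<otimes> b \<oplus> c) = \<zero>"
    by (simp add: l_minus a_ac r_neg r_neg1 r_neg2)
  have "y \<otimes>\<^bsub>unitriangular_group R 3\<^esub> x = \<one>\<^bsub>unitriangular_group R 3\<^esub>"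
    using 5 key
    by (intro mat3_eqI) (simp_all add: unitriangular_group_def all_less_3 finsum_lessThan_3
        less_Suc_eq numeral_eq_Suc[of "num.Bit0 num.One"] y_def a_def b_def c_def
        r_neg l_neg a_ac)
  with y show ?case by blast
qed

lemma group_heisenberg_group:
  assumes "N > 1"
  shows "group (heisenberg_group N)"
proof -
  interpret residues "int N" "residue_ring (int N)"
    using assms by unfold_locales auto
  show ?thesis
    unfolding heisenberg_group_def by (rule group_unitriangular_group_3)
qed

lemma card_carrier_heisenberg_group:
  assumes "N > 1"
  shows "card (carrier (heisenberg_group N)) = N ^ 3"
proof -
  let ?S = "{0..int N - 1}"
  let ?f = "\<lambda>(a, b, c). mat 3 3 (\<lambda>(i, j). if i = j then 1 else
     if i = 0 \<and> j = 1 then a else if i = 1 \<and> j = 2 then b else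
     if i = 0 \<and> j = 2 then c else (0::int))"
  let ?g = "\<lambda>A. (A $$ (0, 1), A $$ (1, 2), A $$ (0, 2))"
  have "bij_betw ?g (carrier (heisenberg_group N)) (?S \<times> ?S \<times> ?S)"
  proof (rule bij_betwI[where g = ?f], goal_cases)
    case 1
    then show ?case
      by (auto simp: heisenberg_group_def unitriangular_group_def residue_ring_def all_less_3)
  next
    case 2
    from assms show ?case
      by (auto simp: heisenberg_group_def unitriangular_group_def residue_ring_def all_less_3
          less_Suc_eq numeral_eq_Suc[of "num.Bit0 num.One"])
  next
    case (3 x)
    then show ?case
      by (intro mat3_eqI) (auto simp: heisenberg_group_def unitriangular_group_def
          residue_ring_def all_less_3 less_Suc_eq numeral_eq_Suc[of "num.Bit0 num.One"])
  next
    case (4 y)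
    then show ?case by auto
  qed
  then show ?thesis
    by (simp add: bij_betw_same_card power3_eq_cube)
qed

end

theory Submission
  imports Defs "HOL-Library.Real_Mod"
begin

text \<open>Composing the commutator with a faithful character of its cyclic target gives a bicharacter
  \<open>\<beta>\<close> on the Heisenberg group \<open>G\<close> with \<open>\<beta> x y = 1\<close> exactly when \<open>x\<close> and \<open>y\<close> commute. Orthogonality
  then yields \<open>m(H) = |G| |H \<inter> Z(G)|\<close> for every subgroup \<open>H\<close>, which is largest at
  \<open>H = G\<close>, where it equals \<open>N\<^sup>3 * N\<close>.\<close>

section \<open>Character sums over subgroups and the measure of a group with a bicharacter\<close>

text \<open>If \<open>\<chi> h \<noteq> 1\<close> for some \<open>h\<close> in \<open>H\<close>,
  translation by \<open>h\<close> permutes \<open>H\<close> and multiplies the sum by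
  \<open>\<chi> h\<close>; without zero divisors this forces the sum to vanish.\<close>

lemma (in group) sum_multiplicative_subgroup:
  fixes \<chi> :: "'a \<Rightarrow> 'c::idom"
  assumes H: "subgroup H G"
    and mult: "\<And>x y. x \<in> H \<Longrightarrow> y \<in> H \<Longrightarrow> \<chi> (x \<otimes> y) = \<chi> x * \<chi> y"
  shows "(\<Sum>x\<in>H. \<chi> x) = (if \<forall>x\<in>H. \<chi> x = 1 then of_nat (card H) else 0)"
proof (cases "\<forall>x\<in>H. \<chi> x = 1")
  case True
  then show ?thesis by simp
next
  case False
  then obtain h where h: "h \<in> H" "\<chi> h \<noteq> 1" by blast
  have bij: "bij_betw (\<lambda>x. h \<otimes> x) H H"
    using h(1) subgroup.subset[OF H] subgroup.m_closed[OF H] subgroup.m_inv_closed[OF H]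
    by (intro bij_betwI[where g = "\<lambda>x. inv h \<otimes> x"]) (auto simp: m_assoc[symmetric] subset_iff)
  have "(\<Sum>x\<in>H. \<chi> x) = (\<Sum>x\<in>H. \<chi> (h \<otimes> x))"
    by (rule sum.reindex_bij_betw[OF bij, symmetric])
  also have "\<dots> = \<chi> h * (\<Sum>x\<in>H. \<chi> x)"
    using h(1) by (simp add: mult sum_distrib_left)
  finally have "(\<chi> h - 1) * (\<Sum>x\<in>H. \<chi> x) = 0" by (simp add: algebra_simps)
  with h show ?thesis by auto
qed

text \<open>Double counting of \<open>\<Sum>h\<in>H. \<Sum>g\<in>G. \<beta> h g\<close>: by orthogonality, the inner sum in either
  order is nonzero only for the elements commuting with everything summed over.\<close>

lemma (in group) cd_measure_of_bicharacter:
  fixes \<beta> :: "'a \<Rightarrow> 'a \<Rightarrow> 'c::{idom, ring_char_0}"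
  assumes fin: "finite (carrier G)" and H: "subgroup H G"
    and left: "\<And>x y z. \<lbrakk>x \<in> carrier G; y \<in> carrier G; z \<in> carrier G\<rbrakk> \<Longrightarrow> \<beta> (x \<otimes> y) z = \<beta> x z * \<beta> y z"
    and right: "\<And>x y z. \<lbrakk>x \<in> carrier G; y \<in> carrier G; z \<in> carrier G\<rbrakk> \<Longrightarrow> \<beta> x (y \<otimes> z) = \<beta> x y * \<beta> x z"
    and comm: "\<And>x y. \<lbrakk>x \<in> carrier G; y \<in> carrier G\<rbrakk> \<Longrightarrow> \<beta> x y = 1 \<longleftrightarrow> x \<otimes> y = y \<otimes> x"
  shows "cd_measure_of G H = order G * card (H \<inter> centralizer G (carrier G))"
proof -
  have sub: "H \<subseteq> carrier G" by (rule subgroup.subset[OF H])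
  have finH: "finite H" using fin sub by (rule rev_finite_subset)
  have "of_nat (order G * card (H \<inter> centralizer G (carrier G))) =
      (\<Sum>h\<in>H. if h \<in> centralizer G (carrier G) then of_nat (order G) else (0::'c))"
    by (simp add: sum.If_cases finH mult.commute Int_def)
  also have "\<dots> = (\<Sum>h\<in>H. \<Sum>g\<in>carrier G. \<beta> h g)"
  proof (rule sum.cong[OF refl])
    fix h assume "h \<in> H"
    then have h: "h \<in> carrier G" using sub by blast
    have "h \<in> centralizer G (carrier G) \<longleftrightarrow> (\<forall>g\<in>carrier G. \<beta> h g = 1)"
      using h by (auto simp: centralizer_def comm)
    with sum_multiplicative_subgroup[OF subgroup_self, of "\<beta> h"] h
    show "(if h \<in> centralizer G (carrier G) then of_nat (order G) else 0) =
        (\<Sum>g\<in>carrier G. \<beta> h g)"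
      by (simp add: right order_def)
  qed
  also have "\<dots> = (\<Sum>g\<in>carrier G. \<Sum>h\<in>H. \<beta> h g)"
    by (rule sum.swap)
  also have "\<dots> = (\<Sum>g\<in>carrier G. if g \<in> centralizer G H then of_nat (card H) else 0)"
  proof (rule sum.cong[OF refl])
    fix g assume g: "g \<in> carrier G"
    have "g \<in> centralizer G H \<longleftrightarrow> (\<forall>h\<in>H. \<beta> h g = 1)"
      using g sub by (auto simp: centralizer_def comm subset_iff)
    with sum_multiplicative_subgroup[OF H, of "\<lambda>h. \<beta> h g"] g sub
    show "(\<Sum>h\<in>H. \<beta> h g) = (if g \<in> centralizer G H then of_nat (card H) else 0)"
      by (simp add: left subset_iff)
  qed
  also have "\<dots> = of_nat (cd_measure_of G H)"
  proof -
    have "carrier G \<inter> centralizer G H = centralizer G H"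
      by (auto simp: centralizer_def)
    then show ?thesis
      by (simp add: sum.If_cases fin cd_measure_of_def mult.commute)
  qed
  \<comment> \<open>The identity was computed in \<open>'c\<close>; characteristic zero makes
    \<open>of_nat\<close> injective, so it descends to the natural numbers.\<close>
  finally show ?thesis by (simp only: of_nat_eq_iff)
qed

text \<open>For fixed \<open>G\<close> the measure of \<open>H\<close> depends only on how much of
  the center \<open>H\<close> contains, and the whole group contains all of it.\<close>

lemma (in group) cd_measure_bicharacter:
  fixes \<beta> :: "'a \<Rightarrow> 'a \<Rightarrow> 'c::{idom, ring_char_0}"
  assumes fin: "finite (carrier G)"
    and "\<And>x y z. \<lbrakk>x \<in> carrier G; y \<in> carrier G; z \<in> carrier G\<rbrakk> \<Longrightarrow> \<beta> (x \<otimes> y) z = \<beta> x z * \<beta> y z"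
    and "\<And>x y z. \<lbrakk>x \<in> carrier G; y \<in> carrier G; z \<in> carrier G\<rbrakk> \<Longrightarrow> \<beta> x (y \<otimes> z) = \<beta> x y * \<beta> x z"
    and "\<And>x y. \<lbrakk>x \<in> carrier G; y \<in> carrier G\<rbrakk> \<Longrightarrow> \<beta> x y = 1 \<longleftrightarrow> x \<otimes> y = y \<otimes> x"
  shows "cd_measure G = order G * card (centralizer G (carrier G))"
  unfolding cd_measure_def
proof (rule Max_eqI)
  let ?Z = "centralizer G (carrier G)"
  have finZ: "finite ?Z" and Z: "carrier G \<inter> ?Z = ?Z"
    using fin by (auto simp: centralizer_def)
  note m = cd_measure_of_bicharacter[where \<beta> = \<beta>, OF fin _ assms(2-4)]
  have "{cd_measure_of G H |H. subgroup H G} \<subseteq> cd_measure_of G ` Pow (carrier G)"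
    using subgroup.subset by blast
  then show "finite {cd_measure_of G H |H. subgroup H G}"
    by (rule finite_subset) (simp add: fin)
  show "k \<le> order G * card ?Z" if "k \<in> {cd_measure_of G H |H. subgroup H G}" for k
    using that finZ by (auto simp: m intro!: card_mono)
  show "order G * card ?Z \<in> {cd_measure_of G H |H. subgroup H G}"
    using m[OF subgroup_self] subgroup_self by (auto simp: Z intro!: exI[of _ "carrier G"])
qed

section \<open>A faithful character of the integers modulo \<open>N\<close>\<close>

text \<open>The standard character of the cyclic group of order \<open>N\<close>, taken on all
  integers so that it applies to expressions in matrix entries that are not reduced modulo
  \<open>N\<close>.\<close>

definition root_char :: "nat \<Rightarrow> int \<Rightarrow> complex" where
  "root_char N k = cis (2 * pi * of_int k / of_nat N)"

lemma root_char_add: "root_char N (j + k) = root_char N j * root_char N k"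
  by (simp add: root_char_def cis_mult add_divide_distrib ring_distribs)

text \<open>Faithfulness: an angle is trivial exactly when it is an integer multiple of
  \<open>2 * pi\<close>. This lets a value of the bicharacter detect commuting.\<close>

lemma root_char_eq_1_iff:
  assumes "N > 0"
  shows "root_char N k = 1 \<longleftrightarrow> int N dvd k"
proof -
  have "root_char N k = 1 \<longleftrightarrow> (\<exists>i::int. 2 * pi * of_int k / of_nat N = of_int i * (2 * pi))"
    by (simp only: root_char_def cis_eq_1_iff)
  also have "\<dots> \<longleftrightarrow> (\<exists>i::int. k = int N * i)"
  proof (rule arg_cong[where f = Ex], rule ext)
    fix i :: int
    have "2 * pi * of_int k / of_nat N = of_int i * (2 * pi) \<longleftrightarrow>
        of_int k = (of_int (int N * i) :: real)"
      using assms by (simp add: field_simps)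
    then show "2 * pi * of_int k / of_nat N = of_int i * (2 * pi) \<longleftrightarrow> k = int N * i"
      by (simp only: of_int_eq_iff)
  qed
  finally show ?thesis by (simp add: dvd_def)
qed

text \<open>Entries of a product in the group are reduced modulo \<open>N\<close>; this invariance
  absorbs the reduction when the character is applied.\<close>

lemma root_char_cong:
  assumes "N > 0" "[j = k] (mod int N)"
  shows "root_char N j = root_char N k"
proof -
  have "root_char N (j - k) = 1"
    using assms by (simp add: root_char_eq_1_iff cong_iff_dvd_diff)
  then show ?thesis using root_char_add[of N "j - k" k] by simp
qed

section \<open>Multiplication and commuting in the Heisenberg group\<close>

text \<open>The additivity of the first two entries will make the bicharacter multiplicative in each
  argument. The asymmetric term \<open>A $$ (0, 1) * B $$ (1, 2)\<close> in the corner is the source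
  of all noncommutativity.\<close>

lemma heisenberg_mult_entries:
  assumes "N > 1" "A \<in> carrier (heisenberg_group N)" "B \<in> carrier (heisenberg_group N)"
  shows "(A \<otimes>\<^bsub>heisenberg_group N\<^esub> B) $$ (0, 1) = (A $$ (0, 1) + B $$ (0, 1)) mod int N"
    and "(A \<otimes>\<^bsub>heisenberg_group N\<^esub> B) $$ (1, 2) = (A $$ (1, 2) + B $$ (1, 2)) mod int N"
    and "(A \<otimes>\<^bsub>heisenberg_group N\<^esub> B) $$ (0, 2) =
      (A $$ (0, 2) + A $$ (0, 1) * B $$ (1, 2) + B $$ (0, 2)) mod int N"
proof -
  interpret residues "int N" "residue_ring (int N)"
    using assms by unfold_locales auto
  \<comment> \<open>Row times column; the summands appear in the order 2, 1, 0 in which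
    \<open>finsum_lessThan_3\<close> unfolds the sum.\<close>
  have entry: "(A \<otimes>\<^bsub>heisenberg_group N\<^esub> B) $$ (i, j) =
      (A $$ (i, 2) * B $$ (2, j) + A $$ (i, 1) * B $$ (1, j) + A $$ (i, 0) * B $$ (0, j)) mod int N"
    if "i < 3" "j < 3" for i j
  proof -
    let ?t = "\<lambda>k. A $$ (i, k) \<otimes>\<^bsub>residue_ring (int N)\<^esub> B $$ (k, j)"
    have "?t k \<in> carrier (residue_ring (int N))" if "k < 3" for k
      using assms \<open>i < 3\<close> \<open>j < 3\<close> that
      by (intro m_closed) (auto simp: heisenberg_group_def unitriangular_group_def)
    then have "(A \<otimes>\<^bsub>heisenberg_group N\<^esub> B) $$ (i, j) =
        ?t 2 \<oplus>\<^bsub>residue_ring (int N)\<^esub> (?t 1 \<oplus>\<^bsub>residue_ring (int N)\<^esub> ?t 0)"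
      using that finsum_lessThan_3[of ?t]
      by (simp add: heisenberg_group_def unitriangular_group_def)
    then show ?thesis
      by (simp add: res_add_eq res_mult_eq mod_simps add.assoc)
  qed
  have unitri: "M $$ (0, 0) = 1" "M $$ (1, 1) = 1" "M $$ (2, 2) = 1"
      "M $$ (1, 0) = 0" "M $$ (2, 0) = 0" "M $$ (2, 1) = 0"
    if "M \<in> carrier (heisenberg_group N)" for M
    using that by (auto simp: heisenberg_group_def unitriangular_group_def res_one_eq res_zero_eq)
  show "(A \<otimes>\<^bsub>heisenberg_group N\<^esub> B) $$ (0, 1) = (A $$ (0, 1) + B $$ (0, 1)) mod int N"
    and "(A \<otimes>\<^bsub>heisenberg_group N\<^esub> B) $$ (1, 2) = (A $$ (1, 2) + B $$ (1, 2)) mod int N"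
    and "(A \<otimes>\<^bsub>heisenberg_group N\<^esub> B) $$ (0, 2) =
      (A $$ (0, 2) + A $$ (0, 1) * B $$ (1, 2) + B $$ (0, 2)) mod int N"
    using assms by (simp_all add: entry unitri del: One_nat_def)
qed

lemma heisenberg_eqI:
  assumes "A \<in> carrier (heisenberg_group N)" "B \<in> carrier (heisenberg_group N)"
    "A $$ (0, 1) = B $$ (0, 1)" "A $$ (1, 2) = B $$ (1, 2)" "A $$ (0, 2) = B $$ (0, 2)"
  shows "A = B"
  using assms
  by (intro mat3_eqI) (auto simp: heisenberg_group_def unitriangular_group_def all_less_3
      less_Suc_eq numeral_eq_Suc[of "num.Bit0 num.One"])

text \<open>The entries \<open>(0, 1)\<close> and \<open>(1, 2)\<close> of a product are symmetric
  in the factors, so the two products can differ only in the corner. Their corner difference modulo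
  \<open>N\<close> is this determinant, which is also the corner entry of the commutator.\<close>

lemma heisenberg_commute_iff:
  assumes "N > 1" and A: "A \<in> carrier (heisenberg_group N)" and B: "B \<in> carrier (heisenberg_group N)"
  shows "A \<otimes>\<^bsub>heisenberg_group N\<^esub> B = B \<otimes>\<^bsub>heisenberg_group N\<^esub> A \<longleftrightarrow>
    int N dvd A $$ (0, 1) * B $$ (1, 2) - B $$ (0, 1) * A $$ (1, 2)"
proof -
  interpret group "heisenberg_group N" by (rule group_heisenberg_group[OF assms(1)])
  have "A \<otimes>\<^bsub>heisenberg_group N\<^esub> B = B \<otimes>\<^bsub>heisenberg_group N\<^esub> A \<longleftrightarrow>
      (A \<otimes>\<^bsub>heisenberg_group N\<^esub> B) $$ (0, 2) = (B \<otimes>\<^bsub>heisenberg_group N\<^esub> A) $$ (0, 2)"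
  proof
    assume "(A \<otimes>\<^bsub>heisenberg_group N\<^esub> B) $$ (0, 2) = (B \<otimes>\<^bsub>heisenberg_group N\<^esub> A) $$ (0, 2)"
    then show "A \<otimes>\<^bsub>heisenberg_group N\<^esub> B = B \<otimes>\<^bsub>heisenberg_group N\<^esub> A"
      by (rule heisenberg_eqI[OF m_closed[OF A B] m_closed[OF B A], rotated 2])
        (simp_all add: heisenberg_mult_entries[OF assms] heisenberg_mult_entries[OF assms(1) B A]
          add.commute del: One_nat_def)
  qed simp
  also have "\<dots> \<longleftrightarrow> int N dvd A $$ (0, 1) * B $$ (1, 2) - B $$ (0, 1) * A $$ (1, 2)"
    by (simp add: heisenberg_mult_entries[OF assms] heisenberg_mult_entries[OF assms(1) B A]
        mod_eq_dvd_iff algebra_simps)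
  finally show ?thesis .
qed

section \<open>The center of the Heisenberg group\<close>

definition heisenberg_elt :: "int \<Rightarrow> int \<Rightarrow> int \<Rightarrow> int mat" where
  "heisenberg_elt a b c = mat 3 3 (\<lambda>(i, j). if i = j then 1 else
     if i = 0 \<and> j = 1 then a else if i = 1 \<and> j = 2 then b else
     if i = 0 \<and> j = 2 then c else 0)"

lemma heisenberg_elt_entries [simp]:
  "heisenberg_elt a b c $$ (0, 1) = a"
  "heisenberg_elt a b c $$ (1, 2) = b"
  "heisenberg_elt a b c $$ (0, 2) = c"
  by (simp_all add: heisenberg_elt_def)

lemma heisenberg_elt_carrier:
  assumes "N > 1" "a \<in> {0..<int N}" "b \<in> {0..<int N}" "c \<in> {0..<int N}"
  shows "heisenberg_elt a b c \<in> carrier (heisenberg_group N)"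
  using assms
  by (auto simp: heisenberg_elt_def heisenberg_group_def unitriangular_group_def residue_ring_def
      all_less_3 less_Suc_eq numeral_eq_Suc[of "num.Bit0 num.One"])

lemma heisenberg_entry_range:
  assumes "A \<in> carrier (heisenberg_group N)" "i < 3" "j < 3"
  shows "A $$ (i, j) \<in> {0..<int N}"
  using assms by (auto simp: heisenberg_group_def unitriangular_group_def residue_ring_def)

text \<open>The determinant that decides commuting is a nondegenerate pairing in the entries
  \<open>(0, 1)\<close> and \<open>(1, 2)\<close>, so a central element has both equal to zero,
  while its corner entry is free.\<close>

lemma heisenberg_center:
  assumes "N > 1"
  shows "centralizer (heisenberg_group N) (carrier (heisenberg_group N)) =
    heisenberg_elt 0 0 ` {0..<int N}"
proof (intro equalityI subsetI)
  fix A assume "A \<in> centralizer (heisenberg_group N) (carrier (heisenberg_group N))"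
  then have A: "A \<in> carrier (heisenberg_group N)"
    and comm: "\<And>B. B \<in> carrier (heisenberg_group N) \<Longrightarrow>
      int N dvd A $$ (0, 1) * B $$ (1, 2) - B $$ (0, 1) * A $$ (1, 2)"
    by (auto simp: centralizer_def heisenberg_commute_iff[OF assms])
  \<comment> \<open>The two elementary test matrices isolate one entry each: the determinant becomes
    \<open>A $$ (0, 1)\<close> for the first and \<open>- A $$ (1, 2)\<close> for the
    second.\<close>
  have "int N dvd A $$ (0, 1)" "int N dvd A $$ (1, 2)"
    using comm[of "heisenberg_elt 0 1 0"] comm[of "heisenberg_elt 1 0 0"] assms
    by (simp_all add: heisenberg_elt_carrier del: One_nat_def)
  \<comment> \<open>Entries are representatives in \<open>{0..<int N}\<close>, where zero is the
    only multiple of \<open>N\<close>.\<close>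
  then have "A $$ (0, 1) = 0" "A $$ (1, 2) = 0"
    using heisenberg_entry_range[OF A, of 0 1] heisenberg_entry_range[OF A, of 1 2]
    by (auto simp: zdvd_not_zless order.strict_iff_order dest!: zdvd_imp_le)
  moreover have c: "A $$ (0, 2) \<in> {0..<int N}"
    by (rule heisenberg_entry_range[OF A]) auto
  ultimately have "A = heisenberg_elt 0 0 (A $$ (0, 2))"
    using A assms by (intro heisenberg_eqI[of _ N] heisenberg_elt_carrier) (auto simp del: One_nat_def)
  with c show "A \<in> heisenberg_elt 0 0 ` {0..<int N}" by blast
next
  fix A assume "A \<in> heisenberg_elt 0 0 ` {0..<int N}"
  then show "A \<in> centralizer (heisenberg_group N) (carrier (heisenberg_group N))"
    using assms
    by (auto simp: centralizer_def heisenberg_elt_carrier heisenberg_commute_iff simp del: One_nat_def)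
qed

lemma card_heisenberg_center:
  assumes "N > 1"
  shows "card (centralizer (heisenberg_group N) (carrier (heisenberg_group N))) = N"
proof -
  have "inj_on (heisenberg_elt 0 0) {0..<int N}"
    by (rule inj_on_inverseI[where g = "\<lambda>A. A $$ (0, 2)"]) simp
  then show ?thesis by (simp add: heisenberg_center[OF assms] card_image)
qed

section \<open>The measure of the Heisenberg group\<close>

theorem cd_measure_heisenberg_group:
  assumes N: "N > 1"
  shows "cd_measure (heisenberg_group N) = N ^ 4"
proof -
  let ?G = "heisenberg_group N"
  \<comment> \<open>The exponent is an integer representing the corner entry of the commutator of
    \<open>A\<close> and \<open>B\<close>.\<close>
  define \<beta> where "\<beta> = (\<lambda>A B :: int mat. root_char N (A $$ (0, 1) * B $$ (1, 2) - B $$ (0, 1) * A $$ (1, 2)))"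
  interpret group ?G by (rule group_heisenberg_group[OF N])
  note entries = heisenberg_mult_entries[OF N]
  have card: "card (carrier ?G) = N ^ 3" by (rule card_carrier_heisenberg_group[OF N])
  have "cd_measure ?G = order ?G * card (centralizer ?G (carrier ?G))"
  proof (rule cd_measure_bicharacter[where \<beta> = \<beta>])
    \<comment> \<open>Infinite sets have cardinality 0 by convention, so the positive value
      \<open>N ^ 3\<close> gives finiteness.\<close>
    show "finite (carrier ?G)" using card N by (intro card_ge_0_finite) simp
  next
    fix A B C assume ABC: "A \<in> carrier ?G" "B \<in> carrier ?G" "C \<in> carrier ?G"
    \<comment> \<open>The exponent is additive in each argument only modulo \<open>N\<close>, which
      is all the character sees; it turns these sums into products.\<close>
    have "[(A \<otimes>\<^bsub>?G\<^esub> B) $$ (0, 1) * C $$ (1, 2) - C $$ (0, 1) * (A \<otimes>\<^bsub>?G\<^esub> B) $$ (1, 2) =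
        (A $$ (0, 1) + B $$ (0, 1)) * C $$ (1, 2) - C $$ (0, 1) * (A $$ (1, 2) + B $$ (1, 2))] (mod int N)"
      using ABC by (intro cong_diff cong_mult cong_refl) (simp_all add: entries cong_def del: One_nat_def)
    with N show "\<beta> (A \<otimes>\<^bsub>?G\<^esub> B) C = \<beta> A C * \<beta> B C"
      unfolding \<beta>_def root_char_add[symmetric]
      by (intro root_char_cong) (simp_all add: algebra_simps)
    have "[A $$ (0, 1) * (B \<otimes>\<^bsub>?G\<^esub> C) $$ (1, 2) - (B \<otimes>\<^bsub>?G\<^esub> C) $$ (0, 1) * A $$ (1, 2) =
        A $$ (0, 1) * (B $$ (1, 2) + C $$ (1, 2)) - (B $$ (0, 1) + C $$ (0, 1)) * A $$ (1, 2)] (mod int N)"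
      using ABC by (intro cong_diff cong_mult cong_refl) (simp_all add: entries cong_def del: One_nat_def)
    with N show "\<beta> A (B \<otimes>\<^bsub>?G\<^esub> C) = \<beta> A B * \<beta> A C"
      unfolding \<beta>_def root_char_add[symmetric]
      by (intro root_char_cong) (simp_all add: algebra_simps)
  next
    fix A B assume "A \<in> carrier ?G" "B \<in> carrier ?G"
    with N show "\<beta> A B = 1 \<longleftrightarrow> A \<otimes>\<^bsub>?G\<^esub> B = B \<otimes>\<^bsub>?G\<^esub> A"
      by (simp add: \<beta>_def root_char_eq_1_iff heisenberg_commute_iff)
  qed
  also have "\<dots> = N ^ 4"
    by (simp add: order_def card card_heisenberg_center[OF N] eval_nat_numeral)
  finally show ?thesis .
qed

theorem theorem7p4:
  fixes p n :: nat
  assumes "prime p" and "n \<ge> 1"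
  shows "cd_measure (heisenberg_group (p ^ n)) = p ^ (4 * n)"
proof -
  \<comment> \<open>The modulus is \<open>N = p ^ n\<close>, and the value \<open>N ^ 4\<close>
    becomes \<open>p ^ (4 * n)\<close>.\<close>
  have "p ^ n > 1"
    using assms prime_gt_1_nat by (intro one_less_power) auto
  then show ?thesis
    by (simp add: cd_measure_heisenberg_group flip: power_mult) (simp add: mult.commute)
qed

end
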